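(* Let $\hat{A}\in\mathbb{DC}_n^{\mathrm{CM}}$. Then the following statements hold: (a) $\hat{A}^{\mathrm{core}}=\hat{A}^{\#}\hat{A}\hat{A}^{\dagger}$; (b) $(\hat{A}^{\mathrm{core}})^{\dagger}=\hat{A}^2\hat{A}^{\dagger}$; (c) $(\hat{A}^{\mathrm{core}})^{\dagger}=(\hat{A}^{\mathrm{core}})^{\#}$; (d) $(\hat{A}^{\mathrm{core}})^{\mathrm{core}}=\hat{A}^2\hat{A}^{\dagger}$; (e) $\hat{A}^{\mathrm{core}}\hat{A}=\hat{A}^{\#}\hat{A}$; (f) $(\hat{A}^{\mathrm{core}})^2\hat{A}=\hat{A}^{\#}$; (g) $\hat{A}^{\mathrm{core}}(\hat{A}^{\mathrm{core}})^{\dagger}=(\hat{A}^{\mathrm{core}})^{\dagger}\hat{A}^{\mathrm{core}}$.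
   Context: Dual complex numbers are $\hat a=a_s+\epsilon a_d$ with $a_s,a_d\in\mathbb{C}$, $\epsilon\ne0$, $\epsilon^2=0$, $\epsilon$ commuting with scalars; they form the ring $\mathbb{DC}$. A matrix $\hat A\in\mathbb{DC}^{m\times n}$ is written $\hat A=A_s+\epsilon A_d$ with $A_s,A_d\in\mathbb{C}^{m\times n}$; $\hat A^*=A_s^*+\epsilon A_d^*$. $\mathbb{DC}_n^{\mathrm{CM}}=\{\hat A\in\mathbb{DC}^{n\times n}:\mathcal R(\hat A^2)=\mathcal R(\hat A)\}$, where $\mathcal R(\hat A)=\{\hat Ax:x\in\mathbb{DC}^n\}$. Generalized inverses of $\hat A\in\mathbb{DC}^{n\times n}$ (each unique when it exists): the dual Moore-Penrose generalized inverse $\hat A^\dagger$ is the $\hat X$ with $\hat A\hat X\hat A=\hat A$, $\hat X\hat A\hat X=\hat X$, $(\hat A\hat X)^*=\hat A\hat X$, $(\hat X\hat A)^*=\hat X\hat A$; the dual group inverse $\hat A^{\#}$ is the $\hat X$ with $\hat A\hat X\hat A=\hat A$, $\hat X\hat A\hat X=\hat X$, $\hat A\hat X=\hat X\hat A$; the dual core generalized inverse $\hat A^{\mathrm{core}}$ is the $\hat X$ with $\hat A\hat X\hat A=\hat A$, $\hat A\hat X^2=\hat X$, $(\hat A\hat X)^*=\hat A\hat X$. For $\hat A\in\mathbb{DC}_n^{\mathrm{CM}}$ all three exist. An equality involving a generalized inverse of $\hat A^{\mathrm{core}}$ includes the assertion that this inverse exists. *)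

theory Defs
  imports "HOL-Analysis.Analysis"
begin

text \<open>The ring of dual complex numbers: \<open>Dual a b\<close> stands for \<open>a + \<epsilon> b\<close> with \<open>\<epsilon>\<^sup>2 = 0\<close>.\<close>

datatype dcomplex = Dual (st_part: complex) (du_part: complex)

lemma dcomplex_eq_iff: "x = y \<longleftrightarrow> st_part x = st_part y \<and> du_part x = du_part y"
  by (cases x; cases y) simp

instantiation dcomplex :: comm_ring_1
begin

definition zero_dcomplex :: dcomplex where "0 = Dual 0 0"

definition one_dcomplex :: dcomplex where "1 = Dual 1 0"

definition plus_dcomplex :: "dcomplex \<Rightarrow> dcomplex \<Rightarrow> dcomplex" where
  "x + y = Dual (st_part x + st_part y) (du_part x + du_part y)"

definition uminus_dcomplex :: "dcomplex \<Rightarrow> dcomplex" where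
  "- x = Dual (- st_part x) (- du_part x)"

definition minus_dcomplex :: "dcomplex \<Rightarrow> dcomplex \<Rightarrow> dcomplex" where
  "x - y = Dual (st_part x - st_part y) (du_part x - du_part y)"

definition times_dcomplex :: "dcomplex \<Rightarrow> dcomplex \<Rightarrow> dcomplex" where
  "x * y = Dual (st_part x * st_part y) (st_part x * du_part y + du_part x * st_part y)"

instance
  by standard
    (auto simp: dcomplex_eq_iff zero_dcomplex_def one_dcomplex_def plus_dcomplex_def
      uminus_dcomplex_def minus_dcomplex_def times_dcomplex_def algebra_simps)

end

definition dual_eps :: dcomplex where "dual_eps = Dual 0 1"

lemma dual_eps_nonzero: "dual_eps \<noteq> 0"
  by (simp add: dual_eps_def zero_dcomplex_def)

lemma dual_eps_square: "dual_eps\<^sup>2 = 0"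
  by (simp add: dual_eps_def zero_dcomplex_def times_dcomplex_def power2_eq_square)

lemma Dual_decomp: "Dual a b = Dual a 0 + dual_eps * Dual b 0"
  by (simp add: dual_eps_def plus_dcomplex_def times_dcomplex_def)

definition dual_cnj :: "dcomplex \<Rightarrow> dcomplex" where
  "dual_cnj x = Dual (cnj (st_part x)) (cnj (du_part x))"

text \<open>The conjugate transpose \<open>A\<^sub>s\<^sup>* + \<epsilon> A\<^sub>d\<^sup>*\<close>; the unit \<open>\<epsilon>\<close> is not conjugated.\<close>

definition dual_adjoint :: "dcomplex ^ 'n ^ 'm \<Rightarrow> dcomplex ^ 'm ^ 'n" where
  "dual_adjoint A = (\<chi> i j. dual_cnj (A $ j $ i))"

definition dual_range :: "dcomplex ^ 'n ^ 'm \<Rightarrow> (dcomplex ^ 'm) set" where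
  "dual_range A = {A *v x | x. True}"

definition DC_CM :: "(dcomplex ^ 'n ^ 'n) set" where
  "DC_CM = {A. dual_range (A ** A) = dual_range A}"

definition is_dual_MP_inverse :: "dcomplex ^ 'n ^ 'n \<Rightarrow> dcomplex ^ 'n ^ 'n \<Rightarrow> bool" where
  "is_dual_MP_inverse A X \<longleftrightarrow>
     A ** X ** A = A \<and> X ** A ** X = X \<and>
     dual_adjoint (A ** X) = A ** X \<and> dual_adjoint (X ** A) = X ** A"

definition is_dual_group_inverse :: "dcomplex ^ 'n ^ 'n \<Rightarrow> dcomplex ^ 'n ^ 'n \<Rightarrow> bool" where
  "is_dual_group_inverse A X \<longleftrightarrow>
     A ** X ** A = A \<and> X ** A ** X = X \<and> A ** X = X ** A"

definition is_dual_core_inverse :: "dcomplex ^ 'n ^ 'n \<Rightarrow> dcomplex ^ 'n ^ 'n \<Rightarrow> bool" where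
  "is_dual_core_inverse A X \<longleftrightarrow>
     A ** X ** A = A \<and> A ** (X ** X) = X \<and> dual_adjoint (A ** X) = A ** X"

text \<open>Each inverse is unique when it exists; when it does not, the value of the corresponding
  function below is unspecified, so statements using it should assert existence separately.\<close>

definition has_dual_MP :: "dcomplex ^ 'n ^ 'n \<Rightarrow> bool" where
  "has_dual_MP A \<longleftrightarrow> (\<exists>X. is_dual_MP_inverse A X)"

definition has_dual_group :: "dcomplex ^ 'n ^ 'n \<Rightarrow> bool" where
  "has_dual_group A \<longleftrightarrow> (\<exists>X. is_dual_group_inverse A X)"

definition has_dual_core :: "dcomplex ^ 'n ^ 'n \<Rightarrow> bool" where
  "has_dual_core A \<longleftrightarrow> (\<exists>X. is_dual_core_inverse A X)"

definition dual_MP :: "dcomplex ^ 'n ^ 'n \<Rightarrow> dcomplex ^ 'n ^ 'n" where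
  "dual_MP A = (THE X. is_dual_MP_inverse A X)"

definition dual_group :: "dcomplex ^ 'n ^ 'n \<Rightarrow> dcomplex ^ 'n ^ 'n" where
  "dual_group A = (THE X. is_dual_group_inverse A X)"

definition dual_core :: "dcomplex ^ 'n ^ 'n \<Rightarrow> dcomplex ^ 'n ^ 'n" where
  "dual_core A = (THE X. is_dual_core_inverse A X)"

end

theory Submission
  imports Defs
begin

text \<open>From \<open>R(A\<^sup>2) = R(A)\<close> one gets \<open>A = A\<^sup>2Y\<close>. By finite dimension \<open>A\<close> is then injective on its
  range, which makes \<open>A Y\<^sup>2\<close> the group inverse \<open>G\<close>. Hence \<open>A\<close> has an inner inverse, and replacing the
  idempotents it induces by orthogonal projections with the same range yields the Moore-Penrose
  inverse \<open>M\<close>; the matrix to be inverted for this has a positive definite standard part. Finally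
  \<open>C = G A M\<close> and \<open>B = A\<^sup>2M\<close> satisfy \<open>C B = B C = A M\<close>, a self-adjoint projection fixing \<open>B\<close> and \<open>C\<close>,
  so \<open>B\<close> is at once the Moore-Penrose, group and core inverse of \<open>C\<close>, the core inverse of \<open>A\<close>.\<close>

lemma matrix_add_rdistrib: "(B + C) ** A = B ** A + C ** (A :: 'a::semiring_1 ^ 'n ^ 'm)"
  by (simp add: vec_eq_iff matrix_matrix_mult_def distrib_right sum.distrib)

lemma matrix_diff_ldistrib: "A ** (B - C) = A ** B - A ** (C :: 'a::ring_1 ^ 'n ^ 'm)"
  by (simp add: vec_eq_iff matrix_matrix_mult_def right_diff_distrib sum_subtractf)

lemma matrix_diff_rdistrib: "(B - C) ** A = B ** A - C ** (A :: 'a::ring_1 ^ 'n ^ 'm)"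
  by (simp add: vec_eq_iff matrix_matrix_mult_def left_diff_distrib sum_subtractf)

lemma matrix_mult_minus_left: "(- A) ** B = - (A ** (B :: 'a::ring_1 ^ 'n ^ 'm))"
  by (simp add: vec_eq_iff matrix_matrix_mult_def sum_negf)

lemma matrix_mult_minus_right: "A ** (- B) = - (A ** (B :: 'a::ring_1 ^ 'n ^ 'm))"
  by (simp add: vec_eq_iff matrix_matrix_mult_def sum_negf)

lemma matrix_mult_zero_right: "A ** 0 = (0 :: 'a::ring_1 ^ 'n ^ 'm)"
  by (simp add: vec_eq_iff matrix_matrix_mult_def)

lemmas matrix_ring_simps =
  matrix_add_ldistrib matrix_add_rdistrib matrix_diff_ldistrib matrix_diff_rdistrib
  matrix_mult_zero_right matrix_mul_assoc

section \<open>Standard and dual parts\<close>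

lemma st_part_simps [simp]:
  "st_part 0 = 0" "st_part 1 = 1" "st_part (x + y) = st_part x + st_part y"
  "st_part (x - y) = st_part x - st_part y" "st_part (x * y) = st_part x * st_part y"
  by (simp_all add: zero_dcomplex_def one_dcomplex_def plus_dcomplex_def minus_dcomplex_def
      times_dcomplex_def)

lemma du_part_simps [simp]:
  "du_part 0 = 0" "du_part 1 = 0" "du_part (x + y) = du_part x + du_part y"
  "du_part (x - y) = du_part x - du_part y"
  "du_part (x * y) = st_part x * du_part y + du_part x * st_part y"
  by (simp_all add: zero_dcomplex_def one_dcomplex_def plus_dcomplex_def minus_dcomplex_def
      times_dcomplex_def)

lemma st_part_sum: "st_part (sum f S) = (\<Sum>i\<in>S. st_part (f i))"
  by (induction S rule: infinite_finite_induct) auto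

lemma du_part_sum: "du_part (sum f S) = (\<Sum>i\<in>S. du_part (f i))"
  by (induction S rule: infinite_finite_induct) auto

definition st_mat :: "dcomplex ^ 'n ^ 'm \<Rightarrow> complex ^ 'n ^ 'm" where
  "st_mat A = (\<chi> i j. st_part (A $ i $ j))"

definition du_mat :: "dcomplex ^ 'n ^ 'm \<Rightarrow> complex ^ 'n ^ 'm" where
  "du_mat A = (\<chi> i j. du_part (A $ i $ j))"

definition dual_mat :: "complex ^ 'n ^ 'm \<Rightarrow> complex ^ 'n ^ 'm \<Rightarrow> dcomplex ^ 'n ^ 'm" where
  "dual_mat S D = (\<chi> i j. Dual (S $ i $ j) (D $ i $ j))"

lemma dcomplex_matrix_eq_iff: "A = B \<longleftrightarrow> st_mat A = st_mat B \<and> du_mat A = du_mat B"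
  by (auto simp: st_mat_def du_mat_def vec_eq_iff dcomplex_eq_iff)

lemma st_mat_simps [simp]:
  "st_mat (dual_mat S D) = S" "st_mat 0 = 0" "st_mat (mat 1) = mat 1"
  "st_mat (A + B) = st_mat A + st_mat B" "st_mat (A - B) = st_mat A - st_mat B"
  "st_mat (A ** C) = st_mat A ** st_mat C"
  by (simp_all add: st_mat_def dual_mat_def vec_eq_iff mat_def matrix_matrix_mult_def st_part_sum)

lemma du_mat_simps [simp]:
  "du_mat (dual_mat S D) = D" "du_mat 0 = 0" "du_mat (mat 1) = 0"
  "du_mat (A + B) = du_mat A + du_mat B" "du_mat (A - B) = du_mat A - du_mat B"
  "du_mat (A ** C) = st_mat A ** du_mat C + du_mat A ** st_mat C"
  by (simp_all add: st_mat_def du_mat_def dual_mat_def vec_eq_iff mat_def matrix_matrix_mult_def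
      du_part_sum sum.distrib)

text \<open>If \<open>M\<close> inverts the standard part, then \<open>M A = 1 + \<epsilon>N\<close>, which is inverted by \<open>1 - \<epsilon>N\<close>.\<close>
lemma dual_invertibleI:
  fixes A :: "dcomplex ^ 'n ^ 'n"
  assumes "invertible (st_mat A)"
  shows "\<exists>V. A ** V = mat 1 \<and> V ** A = mat 1"
proof -
  obtain M where M: "st_mat A ** M = mat 1" "M ** st_mat A = mat 1"
    using assms by (auto simp: invertible_def)
  define N where "N = M ** du_mat A ** M"
  define V where "V = dual_mat M (- N)"
  have "st_mat A ** N = du_mat A ** M" "N ** st_mat A = M ** du_mat A"
    unfolding N_def using M by (metis matrix_mul_assoc matrix_mul_lid matrix_mul_rid)+
  then have "A ** V = mat 1" "V ** A = mat 1"
    using M by (simp_all add: dcomplex_matrix_eq_iff V_def matrix_mult_minus_left matrix_mult_minus_right)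
  then show ?thesis by blast
qed

section \<open>The group inverse\<close>

text \<open>Multiplication by \<open>S\<close> maps its range onto itself, so by finite dimension it is injective there.\<close>
lemma range_surj_imp_inj:
  fixes S :: "'a::field ^ 'n ^ 'n"
  assumes "S ** S ** Y = S" "S ** S ** X = 0"
  shows "S ** X = 0"
proof -
  let ?V = "range ((*v) S)"
  have V: "vec.subspace ?V"
    using vec.subspace_image[OF vec.subspace_UNIV] by blast
  obtain B where B: "B \<subseteq> ?V" "vec.independent B" "?V \<subseteq> vec.span B" "card B = vec.dim ?V"
    using vec.basis_exists by blast
  have fB: "finite B" using B(2) by (rule vec.finiteI_independent)
  have span: "vec.span B = ?V"
    using B(1,3) V by (metis subset_antisym vec.span_minimal)
  have im: "vec.span ((*v) S ` B) = (*v) S ` ?V"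
    using span by (simp add: vec.span_image)
  have "?V \<subseteq> (*v) S ` ?V"
  proof
    fix v assume "v \<in> ?V"
    then obtain x where "v = (S ** S ** Y) *v x" using assms(1) by auto
    then have "v = S *v (S *v (Y *v x))" by (simp add: matrix_vector_mul_assoc matrix_mul_assoc)
    then show "v \<in> (*v) S ` ?V" by blast
  qed
  then have onto: "?V \<subseteq> vec.span ((*v) S ` B)" using im by simp
  have sub: "(*v) S ` B \<subseteq> ?V" by auto
  have "card ((*v) S ` B) \<le> vec.dim ?V"
    using B(4) card_image_le[OF fB] by metis
  \<comment> \<open>A spanning set of \<open>?V\<close> with at most \<open>vec.dim ?V\<close>
    elements is independent. Counting then makes the map injective on \<open>B\<close>, hence on its
    span.\<close>
  then have ind: "vec.independent ((*v) S ` B)"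
    using vec.card_le_dim_spanning[OF sub onto] fB by blast
  have "vec.dim ?V \<le> card ((*v) S ` B)"
    using onto fB by (intro vec.dim_le_card) auto
  then have "inj_on ((*v) S) B"
    using B(4) fB card_image_le[OF fB, of "(*v) S"] by (intro eq_card_imp_inj_on) auto
  then have inj: "inj_on ((*v) S) ?V"
    using vec.inj_on_span_independent_image[OF ind] span by simp
  have "(S ** X) *v v = 0" for v
  proof (rule inj_onD[OF inj])
    have "S *v ((S ** X) *v v) = (S ** S ** X) *v v"
      by (simp add: matrix_vector_mul_assoc matrix_mul_assoc)
    then show "S *v ((S ** X) *v v) = S *v 0" using assms(2) by simp
    show "(S ** X) *v v \<in> ?V" by (simp flip: matrix_vector_mul_assoc)
    show "0 \<in> ?V" using V by (rule vec.subspace_0)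
  qed
  then show ?thesis by (simp add: matrix_eq)
qed

text \<open>The complex case is applied three times. Once \<open>S ** x = 0\<close> and
  \<open>S ** (P ** x) = 0\<close> are known, the \<epsilon>-coefficient of \<open>Y\<close> puts
  \<open>D ** x\<close> in the range of \<open>S\<close>, so the \<epsilon>-coefficient of
  \<open>X\<close> takes the form \<open>S ** S ** ?z = 0\<close>.\<close>

lemma dual_range_surj_imp_inj:
  fixes A :: "dcomplex ^ 'n ^ 'n"
  assumes Y: "A ** A ** Y = A" and X: "A ** A ** X = 0"
  shows "A ** X = 0"
proof -
  define S D P Q x d where defs: "S = st_mat A" "D = du_mat A" "P = st_mat Y" "Q = du_mat Y"
    "x = st_mat X" "d = du_mat X"
  have SP: "S ** S ** P = S" and SQ: "S ** S ** Q + (S ** D + D ** S) ** P = D"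
    and "S ** S ** x = 0" and Sd: "S ** S ** d + (S ** D + D ** S) ** x = 0"
    using X Y by (auto simp: dcomplex_matrix_eq_iff defs)
  note inj = range_surj_imp_inj[OF SP]
  have Sx: "S ** x = 0" using \<open>S ** S ** x = 0\<close> by (rule inj)
  have "S ** S ** (P ** x) = 0" using SP Sx by (simp add: matrix_mul_assoc)
  then have SPx: "S ** (P ** x) = 0" by (rule inj)
  have "D ** x = (S ** S ** Q + (S ** D + D ** S) ** P) ** x" using SQ by simp
  also have "\<dots> = S ** (S ** Q ** x + D ** P ** x) + D ** (S ** (P ** x))"
    by (simp add: matrix_ring_simps algebra_simps)
  finally have Dx: "D ** x = S ** (S ** Q ** x + D ** P ** x)"
    using SPx by (simp only: matrix_mult_zero_right add_0_right)
  let ?z = "d + (S ** Q ** x + D ** P ** x)"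
  have "S ** S ** ?z = S ** S ** d + S ** (D ** x)"
    using Dx by (simp add: matrix_ring_simps)
  also have "\<dots> = S ** S ** d + (S ** D + D ** S) ** x"
    using Sx by (simp add: matrix_add_rdistrib matrix_mul_assoc[symmetric] matrix_mult_zero_right)
  finally have "S ** ?z = 0" using Sd by (intro inj) simp
  then have "S ** d + D ** x = 0" using Dx by (simp add: matrix_add_ldistrib)
  then show ?thesis using Sx by (simp add: dcomplex_matrix_eq_iff defs)
qed

lemma DC_CM_factor:
  fixes A :: "dcomplex ^ 'n ^ 'n"
  assumes "A \<in> DC_CM"
  shows "\<exists>Y. A ** A ** Y = A"
proof -
  have "\<exists>y. A ** A *v y = A *v x" for x
  proof -
    have "A *v x \<in> dual_range (A ** A)"
      using assms by (auto simp: DC_CM_def dual_range_def)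
    then show ?thesis by (auto simp: dual_range_def eq_commute)
  qed
  \<comment> \<open>Each column of \<open>A\<close> lies in the range of \<open>A ** A\<close>; the
    chosen preimages become the columns of \<open>Y\<close>.\<close>
  then obtain y where y: "\<And>j. A ** A *v y j = A *v (axis j 1)"
    using choice[of "\<lambda>j y. A ** A *v y = A *v (axis j 1)"] by blast
  have "(A ** A ** (\<chi> i j. y j $ i)) $ i $ j = (A ** A *v y j) $ i" for i j
    by (simp add: matrix_matrix_mult_def matrix_vector_mult_def)
  moreover have "(A *v (axis j 1)) $ i = A $ i $ j" for i j
    by (simp add: matrix_vector_mult_def axis_def if_distrib cong: if_cong)
  ultimately have "A ** A ** (\<chi> i j. y j $ i) = A"
    by (simp add: vec_eq_iff y)
  then show ?thesis by blast
qed

lemma DC_CM_imp_has_dual_group: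
  assumes "A \<in> DC_CM"
  shows "has_dual_group A"
proof -
  obtain Y where Y: "A ** A ** Y = A" using DC_CM_factor[OF assms] by blast
  have cancel: "A ** U = A ** V" if "A ** A ** U = A ** A ** V" for U V
    using dual_range_surj_imp_inj[OF Y, of "U - V"] that by (simp add: matrix_diff_ldistrib)
  \<comment> \<open>With \<open>G = A ** Y ** Y\<close>, the next facts make \<open>A ** G\<close>
    and \<open>G ** A\<close> both equal to \<open>A ** Y\<close>.\<close>
  have AYA: "A ** (Y ** A) = A ** mat 1"
    by (rule cancel) (simp add: matrix_mul_assoc Y)
  have AYYA: "A ** (Y ** Y ** A) = A ** Y"
    using AYA by (intro cancel) (simp add: matrix_mul_assoc Y)
  have "A ** (A ** Y ** Y) = A ** Y" by (simp add: matrix_mul_assoc Y)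
  then have "is_dual_group_inverse A (A ** Y ** Y)"
    unfolding is_dual_group_inverse_def using AYA AYYA Y by (simp add: matrix_mul_assoc)
  then show ?thesis by (auto simp: has_dual_group_def)
qed

section \<open>The Moore-Penrose inverse\<close>

lemma dual_cnj_simps [simp]:
  "dual_cnj (dual_cnj x) = x" "dual_cnj 0 = 0" "dual_cnj 1 = 1"
  "dual_cnj (x + y) = dual_cnj x + dual_cnj y" "dual_cnj (x - y) = dual_cnj x - dual_cnj y"
  "dual_cnj (x * y) = dual_cnj x * dual_cnj y"
  by (simp_all add: dual_cnj_def dcomplex_eq_iff)

lemma dual_cnj_sum: "dual_cnj (sum f S) = (\<Sum>i\<in>S. dual_cnj (f i))"
  by (induction S rule: infinite_finite_induct) auto

lemma dual_adjoint_simps [simp]: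
  "dual_adjoint (dual_adjoint A) = A" "dual_adjoint (mat 1) = mat 1"
  "dual_adjoint (A + B) = dual_adjoint A + dual_adjoint B"
  "dual_adjoint (A - B) = dual_adjoint A - dual_adjoint B"
  by (simp_all add: dual_adjoint_def vec_eq_iff mat_def)

lemma dual_adjoint_mult: "dual_adjoint (A ** B) = dual_adjoint B ** dual_adjoint A"
  by (simp add: dual_adjoint_def vec_eq_iff matrix_matrix_mult_def dual_cnj_sum mult.commute)

text \<open>Pairing a kernel vector \<open>v\<close> with its own equation gives
  \<open>|v|^2 + |K v|^2 = 0\<close>, so the kernel is trivial.\<close>

lemma invertible_one_plus_gram:
  fixes K :: "complex ^ 'n ^ 'm"
  shows "invertible (mat 1 + (\<chi> i j. cnj (K $ j $ i)) ** K)"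
proof -
  let ?H = "\<chi> i j. cnj (K $ j $ i)"
  have "v = 0" if "(mat 1 + ?H ** K) *v v = 0" for v
  proof -
    define w where "w = K *v v"
    have cnj_w: "cnj (w $ j) = (\<Sum>i\<in>UNIV. cnj (v $ i) * cnj (K $ j $ i))" for j
      by (simp add: w_def matrix_vector_mult_def mult.commute)
    have "v + ?H *v w = 0"
      using that by (simp add: w_def matrix_vector_mult_add_rdistrib matrix_vector_mul_assoc)
    then have "(\<Sum>i\<in>UNIV. cnj (v $ i) * (v + ?H *v w) $ i) = 0" by simp
    moreover have "(\<Sum>i\<in>UNIV. cnj (v $ i) * (?H *v w) $ i)
        = (\<Sum>i\<in>UNIV. \<Sum>j\<in>UNIV. cnj (v $ i) * cnj (K $ j $ i) * w $ j)"
      by (simp add: matrix_vector_mult_def sum_distrib_left mult.assoc)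
    moreover have "\<dots> = (\<Sum>j\<in>UNIV. cnj (w $ j) * w $ j)"
      by (subst sum.swap) (simp only: cnj_w sum_distrib_right)
    ultimately have "(\<Sum>i\<in>UNIV. cnj (v $ i) * v $ i) + (\<Sum>j\<in>UNIV. cnj (w $ j) * w $ j) = 0"
      by (simp add: distrib_left sum.distrib)
    moreover have "cnj z * z = of_real ((cmod z)\<^sup>2)" for z
      by (simp only: complex_norm_square mult.commute)
    ultimately have "of_real ((\<Sum>i\<in>UNIV. (cmod (v $ i))\<^sup>2) + (\<Sum>j\<in>UNIV. (cmod (w $ j))\<^sup>2))
        = (0 :: complex)"
      by simp
    then have "(\<Sum>i\<in>UNIV. (cmod (v $ i))\<^sup>2) + (\<Sum>j\<in>UNIV. (cmod (w $ j))\<^sup>2) = 0"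
      by (simp only: of_real_eq_0_iff)
    then have "(\<Sum>i\<in>UNIV. (cmod (v $ i))\<^sup>2) = 0"
      by (meson add_nonneg_eq_0_iff sum_nonneg zero_le_power2)
    then show "v = 0"
      by (simp add: sum_nonneg_eq_0_iff vec_eq_iff)
  qed
  then show ?thesis
    by (metis invertible_left_inverse matrix_left_invertible_ker)
qed

text \<open>For an idempotent \<open>E\<close>, the matrix \<open>U = 1 + (E - E\<^sup>*)\<^sup>*(E - E\<^sup>*)\<close> is invertible and commutes
  with \<open>E\<close> and \<open>E\<^sup>*\<close>; the orthogonal projection onto the range of \<open>E\<close> is \<open>E E\<^sup>* U\<^sup>-\<^sup>1\<close>.\<close>
lemma idempotent_orthogonal_projection:
  fixes E :: "dcomplex ^ 'n ^ 'n"
  assumes EE: "E ** E = E"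
  shows "\<exists>W. E ** W ** E = E \<and> dual_adjoint (E ** W) = E ** W"
proof -
  let ?F = "dual_adjoint E"
  let ?K = "E - ?F"
  define U where "U = mat 1 + dual_adjoint ?K ** ?K"
  have FF: "?F ** ?F = ?F" using EE by (metis dual_adjoint_mult)
  have "st_mat U = mat 1 + (\<chi> i j. cnj (st_mat ?K $ j $ i)) ** st_mat ?K"
    unfolding U_def st_mat_simps
    by (simp add: st_mat_def dual_adjoint_def dual_cnj_def)
  then have "invertible (st_mat U)" by (simp only: invertible_one_plus_gram)
  then obtain V where V: "U ** V = mat 1" "V ** U = mat 1" using dual_invertibleI by blast
  \<comment> \<open>Expanded, \<open>U = 1 - E - ?F + E ** ?F + ?F ** E\<close>; multiplying by
    \<open>E\<close> or \<open>?F\<close> on either side cancels all but one term.\<close>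
  have EU: "E ** U = E ** ?F ** E" and UE: "U ** E = E ** ?F ** E"
    and FU: "?F ** U = ?F ** E ** ?F" and UF: "U ** ?F = ?F ** E ** ?F"
    using EE FF unfolding U_def
    by (simp_all add: matrix_ring_simps)
      (simp_all add: matrix_mul_assoc[symmetric])
  have adjU: "dual_adjoint U = U" by (simp add: U_def dual_adjoint_mult)
  have commute: "V ** Z = Z ** V" if "U ** Z = Z ** U" for Z
    by (metis V that matrix_mul_assoc matrix_mul_lid matrix_mul_rid)
  have VE: "V ** E = E ** V" and VF: "V ** ?F = ?F ** V"
    using EU UE FU UF by (simp_all add: commute)
  have adjV: "dual_adjoint V = V"
    by (metis V adjU dual_adjoint_mult dual_adjoint_simps(2) matrix_mul_assoc matrix_mul_lid
        matrix_mul_rid)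
  let ?W = "?F ** V"
  \<comment> \<open>\<open>E ** ?F ** V ** E = E ** ?F ** E ** V = E ** U ** V = E\<close>.\<close>
  have "E ** ?W ** E = E"
    by (metis EU V(1) VE matrix_mul_assoc matrix_mul_rid)
  moreover have "dual_adjoint (E ** ?W) = E ** ?W"
    by (simp add: dual_adjoint_mult adjV) (metis VE VF matrix_mul_assoc)
  ultimately show ?thesis by blast
qed

text \<open>The idempotent \<open>A ** X\<close> fixes \<open>A\<close>, so an orthogonal projection
  with the range of \<open>A ** X\<close> fixes \<open>A\<close> as well.\<close>

lemma dual_inner_inverse_adjoint:
  fixes A :: "dcomplex ^ 'n ^ 'n"
  assumes "A ** X ** A = A"
  shows "\<exists>W. A ** W ** A = A \<and> dual_adjoint (A ** W) = A ** W"
proof -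
  let ?E = "A ** X"
  have "?E ** ?E = ?E" using assms by (simp add: matrix_mul_assoc)
  then obtain W where W: "?E ** W ** ?E = ?E" "dual_adjoint (?E ** W) = ?E ** W"
    using idempotent_orthogonal_projection by blast
  have "A ** (X ** W) ** A = A"
    using W(1) assms by (metis matrix_mul_assoc)
  moreover have "dual_adjoint (A ** (X ** W)) = A ** (X ** W)"
    using W(2) by (simp add: matrix_mul_assoc)
  ultimately show ?thesis by blast
qed

text \<open>Inner inverses \<open>W\<close> and \<open>T\<close> are found separately, with
  \<open>A ** W\<close> and, by passing to the adjoint, \<open>T ** A\<close> self-adjoint;
  \<open>T ** A ** W\<close> inherits both symmetries.\<close>

lemma has_dual_MP_if_inner_inverse:
  assumes X: "A ** X ** A = A"
  shows "has_dual_MP A"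
proof -
  let ?B = "dual_adjoint A"
  obtain W where W: "A ** W ** A = A" "dual_adjoint (A ** W) = A ** W"
    using dual_inner_inverse_adjoint[OF X] by blast
  have "?B ** dual_adjoint X ** ?B = ?B"
    using X by (metis dual_adjoint_mult matrix_mul_assoc)
  then obtain Z where Z: "?B ** Z ** ?B = ?B" "dual_adjoint (?B ** Z) = ?B ** Z"
    using dual_inner_inverse_adjoint by blast
  define T where "T = dual_adjoint Z"
  have T: "A ** T ** A = A" "dual_adjoint (T ** A) = T ** A"
    using Z unfolding T_def by (metis dual_adjoint_mult dual_adjoint_simps(1) matrix_mul_assoc)+
  have "A ** (T ** A ** W) = A ** W" "T ** A ** W ** A = T ** A"
    using T(1) W(1) by (simp_all add: matrix_mul_assoc) (metis matrix_mul_assoc)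
  moreover from this have "T ** A ** W ** A ** (T ** A ** W) = T ** A ** W"
    using T(1) by (metis matrix_mul_assoc)
  ultimately have "is_dual_MP_inverse A (T ** A ** W)"
    unfolding is_dual_MP_inverse_def using T W by simp
  then show ?thesis by (auto simp: has_dual_MP_def)
qed

section \<open>Uniqueness\<close>

lemma dual_group_eqI:
  assumes X: "is_dual_group_inverse A X"
  shows "dual_group A = X"
  unfolding dual_group_def
proof (rule the_equality, rule X)
  fix Y assume Y: "is_dual_group_inverse A Y"
  \<comment> \<open>Commuting both factors, \<open>A ** X = (A ** Y) ** (A ** X) = (Y ** A) ** (X **
    A) = Y ** A\<close>.\<close>
  have "A ** X = A ** Y"
    using X Y unfolding is_dual_group_inverse_def by (metis matrix_mul_assoc)
  then show "Y = X"
    using X Y unfolding is_dual_group_inverse_def by (metis matrix_mul_assoc)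
qed

text \<open>Each projection absorbs the other: \<open>(A ** X) ** (A ** Y) = A ** Y\<close>, whose
  adjoint reads \<open>(A ** Y) ** (A ** X) = A ** Y\<close>, while the left side is also
  \<open>A ** X\<close>.\<close>

lemma adjoint_projections_eq:
  assumes "A ** X ** A = A" "dual_adjoint (A ** X) = A ** X"
    and "A ** Y ** A = A" "dual_adjoint (A ** Y) = A ** Y"
  shows "A ** X = A ** Y"
  using assms by (metis dual_adjoint_mult matrix_mul_assoc)

lemma adjoint_coprojections_eq:
  assumes "A ** X ** A = A" "dual_adjoint (X ** A) = X ** A"
    and "A ** Y ** A = A" "dual_adjoint (Y ** A) = Y ** A"
  shows "X ** A = Y ** A"
  using assms by (metis dual_adjoint_mult matrix_mul_assoc)

lemma dual_MP_eqI:
  assumes X: "is_dual_MP_inverse A X"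
  shows "dual_MP A = X"
  unfolding dual_MP_def
proof (rule the_equality, rule X)
  fix Y assume Y: "is_dual_MP_inverse A Y"
  have "A ** X = A ** Y" "X ** A = Y ** A"
    using X Y unfolding is_dual_MP_inverse_def
    by (blast intro: adjoint_projections_eq adjoint_coprojections_eq)+
  then show "Y = X"
    using X Y unfolding is_dual_MP_inverse_def by (metis matrix_mul_assoc)
qed

text \<open>With \<open>G\<close> the group inverse, \<open>A X\<^sup>2 = X\<close> gives \<open>G A X = G A\<^sup>2 X\<^sup>2 = A X\<^sup>2 = X\<close>, so a core inverse
  \<open>X\<close> is determined by \<open>A X\<close>.\<close>
lemma dual_core_eqI:
  assumes G: "is_dual_group_inverse A G" and X: "is_dual_core_inverse A X"
  shows "dual_core A = X"
  unfolding dual_core_def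
proof (rule the_equality, rule X)
  have GAA: "G ** A ** A = A"
    using G unfolding is_dual_group_inverse_def by metis
  have eq: "G ** (A ** Z) = Z" if "is_dual_core_inverse A Z" for Z
    using that GAA unfolding is_dual_core_inverse_def by (metis matrix_mul_assoc)
  fix Y assume Y: "is_dual_core_inverse A Y"
  have "A ** X = A ** Y"
    using X Y unfolding is_dual_core_inverse_def by (blast intro: adjoint_projections_eq)
  then show "Y = X" using eq X Y by metis
qed

theorem theorem4p17:
  fixes A :: "dcomplex ^ 'n ^ 'n"
  assumes "A \<in> DC_CM"
  shows
    "(has_dual_core A \<and> has_dual_group A \<and> has_dual_MP A \<and>
        dual_core A = dual_group A ** A ** dual_MP A) \<and>
     (has_dual_MP (dual_core A) \<and>
        dual_MP (dual_core A) = A ** A ** dual_MP A) \<and>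
     (has_dual_MP (dual_core A) \<and> has_dual_group (dual_core A) \<and>
        dual_MP (dual_core A) = dual_group (dual_core A)) \<and>
     (has_dual_core (dual_core A) \<and>
        dual_core (dual_core A) = A ** A ** dual_MP A) \<and>
     dual_core A ** A = dual_group A ** A \<and>
     dual_core A ** dual_core A ** A = dual_group A \<and>
     (has_dual_MP (dual_core A) \<and>
        dual_core A ** dual_MP (dual_core A) = dual_MP (dual_core A) ** dual_core A)"
proof -
  obtain G where G: "is_dual_group_inverse A G"
    using DC_CM_imp_has_dual_group[OF assms] by (auto simp: has_dual_group_def)
  have AGA: "A ** G ** A = A" and GAG: "G ** A ** G = G" and comm: "A ** G = G ** A"
    using G unfolding is_dual_group_inverse_def by blast+
  have "has_dual_MP A" using AGA by (rule has_dual_MP_if_inner_inverse)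
  then obtain M where M: "is_dual_MP_inverse A M" by (auto simp: has_dual_MP_def)
  have AMA: "A ** M ** A = A" and adj: "dual_adjoint (A ** M) = A ** M"
    using M by (simp_all add: is_dual_MP_inverse_def)
  define C where "C = G ** A ** M"
  define B where "B = A ** A ** M"
  have AC: "A ** C = A ** M" unfolding C_def using AGA by (metis matrix_mul_assoc)
  have CA: "C ** A = G ** A" unfolding C_def using AMA by (metis matrix_mul_assoc)
  have PC: "A ** M ** C = C" unfolding C_def using AMA comm by (metis matrix_mul_assoc)
  have CP: "C ** (A ** M) = C" unfolding C_def using AMA by (metis matrix_mul_assoc)
  have PB: "A ** M ** B = B" unfolding B_def using AMA by (metis matrix_mul_assoc)
  \<comment> \<open>\<open>C ** A ** A ** M = G ** A ** A ** M = A ** G ** A ** M = A **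
    M\<close>.\<close>
  have CB: "C ** B = A ** M"
    unfolding B_def using CA AGA comm by (metis matrix_mul_assoc)
  have BC: "B ** C = A ** M"
    unfolding B_def using PC AC by (metis matrix_mul_assoc)
  have core: "is_dual_core_inverse A C"
    unfolding is_dual_core_inverse_def using AC AMA PC adj by (metis matrix_mul_assoc)
  have groupC: "is_dual_group_inverse C B"
    unfolding is_dual_group_inverse_def by (simp add: CB BC PC PB)
  have MPC: "is_dual_MP_inverse C B"
    unfolding is_dual_MP_inverse_def by (simp add: CB BC PC PB adj)
  have coreC: "is_dual_core_inverse C B"
    unfolding is_dual_core_inverse_def by (simp add: CB PC PB adj matrix_mul_assoc)
  \<comment> \<open>\<open>C ** (C ** A) = C ** (G ** A) = (C ** A) ** G = G ** A ** G\<close>.\<close>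
  have CCA: "C ** C ** A = G"
    using CA CP GAG comm unfolding C_def by (metis matrix_mul_assoc)
  have "dual_core A = C" "dual_group A = G" "dual_MP A = M"
    "dual_MP C = B" "dual_group C = B" "dual_core C = B"
    using dual_core_eqI[OF G core] dual_group_eqI[OF G] dual_MP_eqI[OF M]
      dual_MP_eqI[OF MPC] dual_group_eqI[OF groupC] dual_core_eqI[OF groupC coreC]
    by simp_all
  moreover have "has_dual_core A" "has_dual_group A" "has_dual_MP A"
    "has_dual_MP C" "has_dual_group C" "has_dual_core C"
    using core G M MPC groupC coreC
    by (auto simp: has_dual_core_def has_dual_group_def has_dual_MP_def)
  ultimately show ?thesis
    using CA CCA CB BC by (simp add: C_def[symmetric] B_def[symmetric])
qed

end
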